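(* Let $d$ be a positive integer and let $$K=\{x\in\mathbb{R}^n:g_i(x)\le 0,\ i\in I,\ h_j(x)=0,\ j\in J\}$$ be nonempty, where $I,J$ are finite index sets, the $g_i$ are convex polynomial functions and the $h_j$ are affine functions on $\mathbb{R}^n$. Suppose that the asymptotic cone of $K$ is given by $K^\infty=\{x\in\mathbb{R}^n:Cx\le 0\}$ with $C\in\mathbb{R}^{s\times n}$. If the LICQ holds on $K^\infty$, i.e. for every $x\in K^\infty$ the rows $C_i$ of $C$ with $C_ix=0$ are linearly independent, then the set $\mathcal{R}_0(K,d)$ is generic in $\mathcal{P}_d$.
   Context: For a nonempty closed convex set $K\subset\mathbb{R}^n$ and a continuous map $F:\mathbb{R}^n\to\mathbb{R}^n$, $\mathrm{SOL}(K,F)$ denotes the set of $x\in K$ such that $\langle F(x),y-x\rangle\ge 0$ for all $y\in K$. The asymptotic cone of $K$ is $K^\infty=\{v\in\mathbb{R}^n:\exists t_k\to\infty,\ \exists x_k\in K,\ x_k/t_k\to v\}$ (the recession cone of $K$). For a polynomial map $Q=(Q_1,\dots,Q_n)$, its degree is $d=\max_l\deg Q_l$, and $Q^\infty=(Q_1^\infty,\dots,Q_n^\infty)$, where $Q_l^\infty$ is the homogeneous component of degree $d$ of $Q_l$. The pair $(K,Q)$ is an $R_0$-pair if $\mathrm{SOL}(K^\infty,Q^\infty)=\{0\}$. $\mathcal{P}_d$ is the finite-dimensional vector space of polynomial maps $\mathbb{R}^n\to\mathbb{R}^n$ all of whose components have degree at most $d$, normed by the Frobenius norm of the matrix of coefficients.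 $\mathcal{R}_0(K,d)$ is the set of all polynomial maps $Q:\mathbb{R}^n\to\mathbb{R}^n$ of degree (exactly) $d$ such that $(K,Q)$ is an $R_0$-pair. A subset of a finite-dimensional real vector space is generic if it contains a countable intersection of dense open subsets of the space. *)

theory Defs
  imports "HOL-Analysis.Analysis" "HOL-Library.Poly_Mapping"
begin

definition SOL :: "(real ^ 'n) set \<Rightarrow> (real ^ 'n \<Rightarrow> real ^ 'n) \<Rightarrow> (real ^ 'n) set" where
  "SOL K F = {x \<in> K. \<forall>y\<in>K. F x \<bullet> (y - x) \<ge> 0}"

definition asymptotic_cone :: "(real ^ 'n) set \<Rightarrow> (real ^ 'n) set" where
  "asymptotic_cone K = {v. \<exists>t :: nat \<Rightarrow> real. \<exists>x :: nat \<Rightarrow> real ^ 'n.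
     filterlim t at_top sequentially \<and> (\<forall>k. x k \<in> K) \<and> (\<lambda>k. x k /\<^sub>R t k) \<longlonglongrightarrow> v}"

definition affine_function :: "(real ^ 'n \<Rightarrow> real) \<Rightarrow> bool" where
  "affine_function h \<longleftrightarrow> (\<exists>a b. \<forall>x. h x = a \<bullet> x + b)"

text \<open>
  The polyhedral cone \<open>{x. C x \<le> 0}\<close> of a matrix with the \<open>s\<close> rows \<open>C 0, \<dots>, C (s - 1)\<close>.
  The number of rows is a natural number and not a type, so that \<open>s = 0\<close> (where the cone is the
  whole space) is included.
\<close>

definition polyhedral_cone :: "nat \<Rightarrow> (nat \<Rightarrow> real ^ 'n) \<Rightarrow> (real ^ 'n) set" where
  "polyhedral_cone s C = {x. \<forall>i<s. C i \<bullet> x \<le> 0}"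

definition active_rows :: "nat \<Rightarrow> (nat \<Rightarrow> real ^ 'n) \<Rightarrow> real ^ 'n \<Rightarrow> nat set" where
  "active_rows s C x = {i. i < s \<and> C i \<bullet> x = 0}"

text \<open>
  The active rows must be independent as a family; since \<^const>\<open>independent\<close> is a property of a
  set of vectors, repeated rows are excluded by the injectivity condition.
\<close>

definition LICQ :: "nat \<Rightarrow> (nat \<Rightarrow> real ^ 'n) \<Rightarrow> bool" where
  "LICQ s C \<longleftrightarrow> (\<forall>x \<in> polyhedral_cone s C.
     inj_on C (active_rows s C x) \<and> independent (C ` active_rows s C x))"

text \<open>
  A polynomial in the variables indexed by \<open>'n\<close> is a finitely supported family of real
  coefficients indexed by the monomials, and a monomial is a family of exponents. A polynomial map
  is a vector of polynomials. Over the reals a polynomial map is determined by its values, so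
  nothing is lost by working with coefficients.
\<close>

type_synonym 'n monomial = "'n \<Rightarrow>\<^sub>0 nat"
type_synonym 'n polynomial = "'n monomial \<Rightarrow>\<^sub>0 real"
type_synonym 'n polynomial_map = "'n polynomial ^ 'n"

definition monomial_degree :: "'n::finite monomial \<Rightarrow> nat" where
  "monomial_degree m = (\<Sum>i\<in>UNIV. Poly_Mapping.lookup m i)"

text \<open>The zero polynomial gets degree \<open>0\<close>.\<close>

definition total_degree :: "'n::finite polynomial \<Rightarrow> nat" where
  "total_degree p = Max (insert 0 (monomial_degree ` Poly_Mapping.keys p))"

definition eval_polynomial :: "'n::finite polynomial \<Rightarrow> real ^ 'n \<Rightarrow> real" where
  "eval_polynomial p x =
     (\<Sum>m\<in>Poly_Mapping.keys p. Poly_Mapping.lookup p m * (\<Prod>i\<in>UNIV. (x $ i) ^ Poly_Mapping.lookup m i))"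

definition homogeneous_component :: "nat \<Rightarrow> 'n::finite polynomial \<Rightarrow> 'n polynomial" where
  "homogeneous_component k p =
     (\<Sum>m\<in>{m \<in> Poly_Mapping.keys p. monomial_degree m = k}.
        Poly_Mapping.single m (Poly_Mapping.lookup p m))"

definition map_degree :: "'n::finite polynomial_map \<Rightarrow> nat" where
  "map_degree Q = Max (range (\<lambda>l. total_degree (Q $ l)))"

definition eval_map :: "'n::finite polynomial_map \<Rightarrow> real ^ 'n \<Rightarrow> real ^ 'n" where
  "eval_map Q x = (\<chi> l. eval_polynomial (Q $ l) x)"

text \<open>
  All components are truncated at the degree of the whole map, so a component of smaller degree
  contributes \<open>0\<close>.
\<close>

definition leading_part :: "'n::finite polynomial_map \<Rightarrow> 'n polynomial_map" where
  "leading_part Q = (\<chi> l. homogeneous_component (map_degree Q) (Q $ l))"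

definition R0_pair :: "(real ^ 'n) set \<Rightarrow> 'n::finite polynomial_map \<Rightarrow> bool" where
  "R0_pair K Q \<longleftrightarrow> SOL (asymptotic_cone K) (eval_map (leading_part Q)) = {0}"

definition R0_maps :: "(real ^ 'n) set \<Rightarrow> nat \<Rightarrow> 'n::finite polynomial_map set" where
  "R0_maps K d = {Q. map_degree Q = d \<and> R0_pair K Q}"

definition polynomial_maps :: "nat \<Rightarrow> 'n::finite polynomial_map set" where
  "polynomial_maps d = {Q. \<forall>l. total_degree (Q $ l) \<le> d}"

text \<open>
  The Frobenius norm of the coefficient matrix, whose entries are indexed by a component and a
  monomial; only the nonzero entries are summed.
\<close>

definition frobenius_norm :: "'n::finite polynomial_map \<Rightarrow> real" where
  "frobenius_norm Q = sqrt (\<Sum>l\<in>UNIV. \<Sum>m\<in>Poly_Mapping.keys (Q $ l). (Poly_Mapping.lookup (Q $ l) m)\<^sup>2)"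

definition frobenius_dist :: "'n::finite polynomial_map \<Rightarrow> 'n polynomial_map \<Rightarrow> real" where
  "frobenius_dist P Q = frobenius_norm (P - Q)"

lemma frobenius_norm_eq_L2_set:
  assumes "finite M" "\<And>l. Poly_Mapping.keys (Q $ l) \<subseteq> M"
  shows "frobenius_norm Q = L2_set (\<lambda>(l, m). Poly_Mapping.lookup (Q $ l) m) (UNIV \<times> M)"
proof -
  have "(\<Sum>m\<in>Poly_Mapping.keys (Q $ l). (Poly_Mapping.lookup (Q $ l) m)\<^sup>2) = (\<Sum>m\<in>M. (Poly_Mapping.lookup (Q $ l) m)\<^sup>2)" for l
    using assms by (intro sum.mono_neutral_left) (auto simp: in_keys_iff)
  then show ?thesis
    unfolding frobenius_norm_def L2_set_def
    by (simp add: sum.cartesian_product case_prod_unfold)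
qed

lemma Metric_space_polynomial_maps:
  "Metric_space (polynomial_maps d :: 'n::finite polynomial_map set) frobenius_dist"
proof
  fix P Q R :: "'n polynomial_map"
  define M where "M = (\<Union>l. Poly_Mapping.keys (P $ l) \<union> Poly_Mapping.keys (Q $ l) \<union> Poly_Mapping.keys (R $ l))"
  have M: "finite M"
    by (simp add: M_def)
  have keysM: "Poly_Mapping.keys ((A - B) $ l) \<subseteq> M" if "A \<in> {P, Q, R}" "B \<in> {P, Q, R}" for A B l
    using that by (auto simp: M_def in_keys_iff lookup_minus intro!: exI[of _ l])
  have eq: "frobenius_dist A B = L2_set (\<lambda>(l, m). Poly_Mapping.lookup (A $ l) m - Poly_Mapping.lookup (B $ l) m) (UNIV \<times> M)"
    if "A \<in> {P, Q, R}" "B \<in> {P, Q, R}" for A B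
    unfolding frobenius_dist_def using frobenius_norm_eq_L2_set[OF M keysM[OF that]]
    by (simp add: lookup_minus)
  show "0 \<le> frobenius_dist P Q"
    by (simp add: eq)
  show "frobenius_dist P Q = frobenius_dist Q P"
    by (simp add: eq L2_set_def case_prod_unfold power2_commute)
  show "frobenius_dist P Q = 0 \<longleftrightarrow> P = Q"
  proof
    assume "frobenius_dist P Q = 0"
    then have *: "Poly_Mapping.lookup (P $ l) m = Poly_Mapping.lookup (Q $ l) m" if "m \<in> M" for l m
      using that M by (auto simp: eq L2_set_eq_0_iff)
    moreover have "Poly_Mapping.lookup (P $ l) m = Poly_Mapping.lookup (Q $ l) m" if "m \<notin> M" for l m
      using that by (auto simp: M_def in_keys_iff)
    ultimately show "P = Q"
      by (metis poly_mapping_eqI vec_eq_iff)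
  qed (simp add: frobenius_dist_def frobenius_norm_def)
  show "frobenius_dist P R \<le> frobenius_dist P Q + frobenius_dist Q R"
    using L2_set_triangle_ineq[of "\<lambda>(l, m). Poly_Mapping.lookup (P $ l) m - Poly_Mapping.lookup (Q $ l) m"
        "\<lambda>(l, m). Poly_Mapping.lookup (Q $ l) m - Poly_Mapping.lookup (R $ l) m" "UNIV \<times> M"]
    by (simp add: eq case_prod_unfold)
qed

definition polynomial_maps_topology :: "nat \<Rightarrow> 'n::finite polynomial_map topology" where
  "polynomial_maps_topology d = Metric_space.mtopology (polynomial_maps d) frobenius_dist"

text \<open>
  The intersection with \<^term>\<open>topspace X\<close> only matters for an empty family \<open>\<U>\<close>.
\<close>

definition generic_in :: "'a topology \<Rightarrow> 'a set \<Rightarrow> bool" where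
  "generic_in X S \<longleftrightarrow> S \<subseteq> topspace X \<and>
     (\<exists>\<U>. countable \<U> \<and> (\<forall>U\<in>\<U>. openin X U \<and> X closure_of U = topspace X) \<and>
          topspace X \<inter> \<Inter>\<U> \<subseteq> S)"

end

theory Submission
  imports Defs
begin

text \<open>
  Write \<open>F\<close> for the degree-\<open>d\<close> part of a map \<open>Q\<close> of degree at most \<open>d\<close>, viewed as a function. The
  argument rests on a necessary condition for solutions of the variational inequality on a
  polyhedral cone \<open>{x. C x \<le> 0}\<close> that involves no inequalities any more: if \<open>A\<close> is the set of rows
  active at a solution \<open>x\<close>, then \<open>x\<close> lies in the subspace \<open>V\<close> on which the rows of \<open>A\<close> vanish, and
  \<open>F x\<close> is orthogonal to \<open>V\<close>, since from \<open>x\<close> one can move a little in every direction of \<open>V\<close>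
  (\<open>SOL_polyhedral_cone_orthogonal\<close>). There are finitely many such \<open>V\<close>, so it suffices to show,
  for a fixed subspace \<open>V\<close>, that for generic \<open>Q\<close> no nonzero \<open>x\<close> in \<open>V\<close> has \<open>F x\<close> orthogonal to \<open>V\<close>.

  By homogeneity such an \<open>x\<close> may be rescaled so that a coordinate \<open>k\<close> of maximal modulus becomes
  \<open>1\<close>. For fixed \<open>k\<close> the normalised \<open>x\<close> range over a compact set, whence the maps without bad points
  form an open set (\<open>openin_nondegenerate_maps\<close>). They are dense because one can perturb \<open>F\<close> by
  \<open>b x\<^sub>k\<^sup>d\<close> with a small vector \<open>b\<close>. On the slice \<open>x\<^sub>k = 1\<close> this adds the constant \<open>b\<close>, so \<open>x\<close> is bad for the
  perturbed map only if \<open>b = v - F x\<close> for some \<open>v\<close> orthogonal to \<open>V\<close>. The sums \<open>x + v\<close> fill an affine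
  hyperplane or nothing, and \<open>x + v \<mapsto> v - F x\<close> is a polynomial map between spaces of the same
  dimension; the bad \<open>b\<close> therefore form a null set (\<open>negligible_bad_shifts\<close>), and null sets have
  dense complement.

  The choice \<open>V = UNIV\<close>, which belongs to the empty set of rows, says that \<open>F\<close> has no nonzero zero;
  this ensures that \<open>Q\<close> has degree exactly \<open>d\<close>, so that \<open>F\<close> is the leading part of \<open>Q\<close>.
\<close>

section \<open>The part of top degree\<close>

definition monomial_value :: "'n::finite monomial \<Rightarrow> real ^ 'n \<Rightarrow> real" where
  "monomial_value m x = (\<Prod>i\<in>UNIV. (x $ i) ^ Poly_Mapping.lookup m i)"

text \<open>
  Truncating at a fixed degree \<open>d\<close>, unlike truncating at the degree of the map itself as in
  \<^const>\<open>leading_part\<close>, makes the result depend linearly on \<open>Q\<close>.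
\<close>

definition top_form :: "nat \<Rightarrow> 'n::finite polynomial_map \<Rightarrow> real ^ 'n \<Rightarrow> real ^ 'n" where
  "top_form d Q = eval_map (\<chi> l. homogeneous_component d (Q $ l))"

lemma finite_monomials_of_degree: "finite {m :: 'n::finite monomial. monomial_degree m = d}"
proof -
  have "Poly_Mapping.lookup m i \<le> d" if "monomial_degree m = d" for m :: "'n monomial" and i
    using that member_le_sum[of i UNIV "Poly_Mapping.lookup m"] by (simp add: monomial_degree_def)
  then have "Poly_Mapping.lookup ` {m :: 'n monomial. monomial_degree m = d} \<subseteq> (UNIV \<rightarrow>\<^sub>E {..d})"
    by auto
  then have "finite (Poly_Mapping.lookup ` {m :: 'n monomial. monomial_degree m = d})"
    by (rule finite_subset) (simp add: finite_PiE)
  then show ?thesis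
    by (rule finite_imageD) (simp add: inj_on_def poly_mapping_eqI)
qed

lemma lookup_homogeneous_component:
  "Poly_Mapping.lookup (homogeneous_component d p) m =
     (if monomial_degree m = d then Poly_Mapping.lookup p m else 0)"
  by (simp add: homogeneous_component_def lookup_sum lookup_single when_def in_keys_iff)

lemma top_form_nth:
  fixes Q :: "'n::finite polynomial_map"
  shows "top_form d Q x $ l =
     (\<Sum>m | monomial_degree m = d. Poly_Mapping.lookup (Q $ l) m * monomial_value m x)"
proof -
  let ?p = "homogeneous_component d (Q $ l)"
  have "top_form d Q x $ l = (\<Sum>m\<in>Poly_Mapping.keys ?p. Poly_Mapping.lookup ?p m * monomial_value m x)"
    by (simp add: top_form_def eval_map_def eval_polynomial_def monomial_value_def)
  also have "\<dots> = (\<Sum>m | monomial_degree m = d. Poly_Mapping.lookup ?p m * monomial_value m x)"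
    by (rule sum.mono_neutral_left)
       (auto simp: finite_monomials_of_degree in_keys_iff lookup_homogeneous_component split: if_splits)
  finally show ?thesis
    by (simp add: lookup_homogeneous_component)
qed

lemma top_form_add: "top_form d (P + Q) x = top_form d P x + top_form d Q x"
  by (simp add: vec_eq_iff top_form_nth lookup_add distrib_right sum.distrib)

lemma top_form_diff: "top_form d (P - Q) x = top_form d P x - top_form d Q x"
  by (simp add: vec_eq_iff top_form_nth lookup_minus left_diff_distrib sum_subtractf)

lemma top_form_scaleR: "top_form d Q (c *\<^sub>R x) = c ^ d *\<^sub>R top_form d Q x"
proof -
  have "monomial_value m (c *\<^sub>R x) = c ^ monomial_degree m * monomial_value m x" for m
    by (simp add: monomial_value_def monomial_degree_def power_mult_distrib prod.distrib power_sum)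
  then show ?thesis
    by (simp add: vec_eq_iff top_form_nth sum_distrib_left mult_ac)
qed

lemma polynomial_function_top_form: "polynomial_function (top_form d Q)"
proof -
  have coord: "real_polynomial_function (\<lambda>x :: real ^ 'n. x $ l)" for l
    by (intro real_polynomial_function.intros(1) bounded_linear_vec_nth)
  have "real_polynomial_function (\<lambda>x. top_form d Q x $ l)" for l
    unfolding top_form_nth monomial_value_def
    by (intro real_polynomial_function_sum finite_monomials_of_degree real_polynomial_function.intros(4)
          real_polynomial_function.intros(2) real_polynomial_function_prod real_polynomial_function_power
          coord finite)
  then show ?thesis
    by (auto simp: polynomial_function_iff_Basis_inner Basis_vec_def inner_axis)
qed

lemma abs_lookup_le_frobenius_norm:
  "\<bar>Poly_Mapping.lookup (Q $ l) m\<bar> \<le> frobenius_norm Q"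
proof (cases "m \<in> Poly_Mapping.keys (Q $ l)")
  case True
  let ?S = "\<lambda>l. \<Sum>m\<in>Poly_Mapping.keys (Q $ l). (Poly_Mapping.lookup (Q $ l) m)\<^sup>2"
  have "(Poly_Mapping.lookup (Q $ l) m)\<^sup>2 \<le> ?S l"
    using True by (intro member_le_sum) auto
  also have "\<dots> \<le> (\<Sum>l\<in>UNIV. ?S l)"
    by (rule member_le_sum) (auto intro: sum_nonneg)
  finally show ?thesis
    unfolding frobenius_norm_def by (rule real_le_rsqrt[OF ord_eq_le_trans[OF power2_abs]])
next
  case False
  then show ?thesis
    by (simp add: in_keys_iff frobenius_norm_def sum_nonneg)
qed

lemma top_form_bounded_on_cube:
  "\<exists>c > 0. \<forall>(Q :: 'n::finite polynomial_map) x.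
     (\<forall>i. \<bar>x $ i\<bar> \<le> 1) \<longrightarrow> norm (top_form d Q x) \<le> c * frobenius_norm Q"
proof (intro exI conjI allI impI)
  let ?M = "{m :: 'n monomial. monomial_degree m = d}"
  show "real CARD('n) * (real (card ?M) + 1) > 0"
    by (intro mult_pos_pos) auto
  fix Q :: "'n polynomial_map" and x :: "real ^ 'n"
  assume x: "\<forall>i. \<bar>x $ i\<bar> \<le> 1"
  have monomial_le: "\<bar>monomial_value m x\<bar> \<le> 1" for m
    unfolding monomial_value_def abs_prod power_abs using x by (intro prod_le_1 conjI power_le_one) auto
  have nonneg: "frobenius_norm Q \<ge> 0"
    using abs_lookup_le_frobenius_norm[of Q undefined undefined] by linarith
  have "\<bar>top_form d Q x $ l\<bar> \<le> (real (card ?M) + 1) * frobenius_norm Q" for l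
  proof -
    have "\<bar>top_form d Q x $ l\<bar> \<le> (\<Sum>m\<in>?M. \<bar>Poly_Mapping.lookup (Q $ l) m * monomial_value m x\<bar>)"
      unfolding top_form_nth by (rule sum_abs)
    also have "\<dots> \<le> (\<Sum>m\<in>?M. frobenius_norm Q * 1)"
      unfolding abs_mult
      by (intro sum_mono mult_mono abs_lookup_le_frobenius_norm monomial_le nonneg) auto
    finally show ?thesis
      using nonneg by (simp add: algebra_simps)
  qed
  then have "(\<Sum>l\<in>UNIV. \<bar>top_form d Q x $ l\<bar>) \<le> of_nat CARD('n) * ((real (card ?M) + 1) * frobenius_norm Q)"
    by (intro sum_bounded_above)
  then show "norm (top_form d Q x) \<le> real CARD('n) * (real (card ?M) + 1) * frobenius_norm Q"
    using norm_le_l1_cart[of "top_form d Q x"] by (simp add: mult.assoc)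
qed

text \<open>The map \<open>x \<mapsto> x\<^sub>k\<^sup>d b\<close>, by which a given map will be perturbed.\<close>

definition coordinate_power_map :: "nat \<Rightarrow> 'n \<Rightarrow> real ^ 'n \<Rightarrow> 'n::finite polynomial_map" where
  "coordinate_power_map d k b = (\<chi> l. Poly_Mapping.single (Poly_Mapping.single k d) (b $ l))"

lemma monomial_degree_single: "monomial_degree (Poly_Mapping.single k d) = d"
  by (simp add: monomial_degree_def lookup_single when_def)

lemma top_form_coordinate_power_map: "top_form d (coordinate_power_map d k b) x = (x $ k) ^ d *\<^sub>R b"
proof -
  have "monomial_value (Poly_Mapping.single k d) x = (x $ k) ^ d"
  proof -
    have "monomial_value (Poly_Mapping.single k d) x = (\<Prod>i\<in>UNIV. if k = i then (x $ i) ^ d else 1)"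
      unfolding monomial_value_def by (rule prod.cong) (auto simp: lookup_single when_def)
    then show ?thesis by simp
  qed
  then show ?thesis
    by (simp add: vec_eq_iff top_form_nth coordinate_power_map_def lookup_single when_def
        finite_monomials_of_degree monomial_degree_single mult.commute if_distrib if_distribR
        cong: if_cong)
qed

lemma frobenius_norm_coordinate_power_map: "frobenius_norm (coordinate_power_map d k b) = norm b"
proof -
  have "(\<Sum>m\<in>Poly_Mapping.keys (coordinate_power_map d k b $ l).
          (Poly_Mapping.lookup (coordinate_power_map d k b $ l) m)\<^sup>2) = (b $ l)\<^sup>2" for l
    by (simp add: coordinate_power_map_def)
  then show ?thesis
    by (simp add: frobenius_norm_def norm_vec_def L2_set_def)
qed

lemma frobenius_norm_minus: "frobenius_norm (- Q) = frobenius_norm Q"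
proof -
  have "Poly_Mapping.keys (- (Q $ l)) = Poly_Mapping.keys (Q $ l)" for l
    by (auto simp: in_keys_iff)
  then show ?thesis
    by (simp add: frobenius_norm_def)
qed

lemma polynomial_maps_iff:
  "Q \<in> polynomial_maps d \<longleftrightarrow> (\<forall>l m. Poly_Mapping.lookup (Q $ l) m \<noteq> 0 \<longrightarrow> monomial_degree m \<le> d)"
  by (auto simp: polynomial_maps_def total_degree_def in_keys_iff)

lemma add_coordinate_power_map_mem:
  assumes "Q \<in> polynomial_maps d"
  shows "Q + coordinate_power_map d k b \<in> polynomial_maps d"
  using assms
  by (auto simp: polynomial_maps_iff coordinate_power_map_def lookup_add lookup_single when_def
      monomial_degree_single split: if_splits)

lemma map_degree_le_imp_polynomial_maps:
  assumes "map_degree Q \<le> d"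
  shows "Q \<in> polynomial_maps d"
  using assms by (simp add: polynomial_maps_def map_degree_def)

lemma map_degree_eq:
  assumes Q: "Q \<in> polynomial_maps d" and nz: "top_form d Q x \<noteq> 0"
  shows "map_degree Q = d"
proof -
  obtain l where "top_form d Q x $ l \<noteq> 0"
    using nz by (auto simp: vec_eq_iff)
  then obtain m where m: "monomial_degree m = d" "Poly_Mapping.lookup (Q $ l) m \<noteq> 0"
    unfolding top_form_nth by (metis (mono_tags, lifting) mem_Collect_eq mult_eq_0_iff sum.neutral)
  then have "d \<le> total_degree (Q $ l)"
    by (auto simp: total_degree_def in_keys_iff intro!: Max_ge)
  also have "\<dots> \<le> map_degree Q"
    by (simp add: map_degree_def)
  finally have "d \<le> map_degree Q" .
  moreover have "map_degree Q \<le> d"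
    using Q by (simp add: polynomial_maps_def map_degree_def)
  ultimately show ?thesis
    by simp
qed

lemma eval_leading_part:
  assumes "map_degree Q = d"
  shows "eval_map (leading_part Q) = top_form d Q"
  using assms by (simp add: leading_part_def top_form_def)

section \<open>Nondegeneracy on a subspace\<close>

text \<open>
  The normalisation \<open>x\<^sub>k = 1\<close>, \<open>\<bar>x\<^sub>i\<bar> \<le> 1\<close> makes the set of test points compact, and yet every
  nonzero point has a multiple satisfying it for some \<open>k\<close>.
\<close>

definition normalised_slice :: "(real ^ 'n) set \<Rightarrow> 'n \<Rightarrow> (real ^ 'n) set" where
  "normalised_slice V k = {x \<in> V. x $ k = 1 \<and> (\<forall>i. \<bar>x $ i\<bar> \<le> 1)}"

definition nondegenerate_maps :: "nat \<Rightarrow> (real ^ 'n) set \<Rightarrow> 'n \<Rightarrow> 'n::finite polynomial_map set" where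
  "nondegenerate_maps d V k =
     {Q \<in> polynomial_maps d. \<forall>x\<in>normalised_slice V k. \<exists>w\<in>V. top_form d Q x \<bullet> w \<noteq> 0}"

lemma compact_normalised_slice:
  fixes V :: "(real ^ 'n::finite) set"
  assumes "subspace V"
  shows "compact (normalised_slice V k)"
proof -
  have "normalised_slice V k = V \<inter> ({x. x $ k = 1} \<inter> cbox (\<chi> i. -1) (\<chi> i. 1))"
    by (auto simp: normalised_slice_def mem_box_cart abs_le_iff minus_le_iff)
  moreover have "closed {x :: real ^ 'n. x $ k = 1}"
    by (intro closed_Collect_eq continuous_intros)
  ultimately show ?thesis
    using closed_subspace[OF assms] by (simp add: closed_Int_compact)
qed

text \<open>
  Scaling by the inverse of a coordinate of maximal modulus may reverse the sign of \<open>x\<close>; this is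
  harmless because a subspace, unlike a cone, is symmetric.
\<close>

lemma nondegenerate_maps_imp_not_orthogonal:
  assumes V: "subspace V" "x \<in> V" and "x \<noteq> 0"
    and Q: "\<And>k. Q \<in> nondegenerate_maps d V k"
  shows "\<exists>w\<in>V. top_form d Q x \<bullet> w \<noteq> 0"
proof -
  define r where "r = Max (range (\<lambda>i. \<bar>x $ i\<bar>))"
  have r: "\<bar>x $ i\<bar> \<le> r" for i
    by (simp add: r_def)
  have "r \<in> range (\<lambda>i. \<bar>x $ i\<bar>)"
    unfolding r_def by (intro Max_in) auto
  then obtain k where k: "\<bar>x $ k\<bar> = r"
    by auto
  obtain i where "x $ i \<noteq> 0"
    using \<open>x \<noteq> 0\<close> by (auto simp: vec_eq_iff)
  then have "r > 0"
    using r[of i] by linarith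
  let ?y = "inverse (x $ k) *\<^sub>R x"
  have "?y \<in> normalised_slice V k"
    using V k r \<open>r > 0\<close>
    by (auto simp: normalised_slice_def subspace_scale abs_mult field_simps)
  then obtain w where "w \<in> V" "top_form d Q ?y \<bullet> w \<noteq> 0"
    using Q[of k] by (auto simp: nondegenerate_maps_def)
  then show ?thesis
    by (auto simp: top_form_scaleR)
qed

lemma orthogonal_projection_exists:
  fixes V :: "'a::euclidean_space set"
  assumes "subspace V"
  obtains P where "linear P" "\<And>x. x \<in> V \<Longrightarrow> P x = x"
    "\<And>v. P v = 0 \<longleftrightarrow> (\<forall>w\<in>V. v \<bullet> w = 0)"
proof -
  obtain B where B: "B \<subseteq> V" "pairwise orthogonal B" "\<And>x. x \<in> B \<Longrightarrow> norm x = 1"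
    "independent B" "span B = V"
    using orthonormal_basis_subspace[OF assms] by metis
  have finB: "finite B"
    using \<open>independent B\<close> independent_imp_finite by blast
  define P where "P = (\<lambda>z. \<Sum>b\<in>B. (z \<bullet> b) *\<^sub>R b)"
  have lin: "linear P"
    unfolding P_def by (intro linearI) (simp_all add: inner_add_left scaleR_add_left sum.distrib scaleR_sum_right)
  have "P c = c" if "c \<in> B" for c
  proof -
    have "P c = (\<Sum>b\<in>B. if c = b then b else 0)"
      unfolding P_def using that B(2,3)
      by (intro sum.cong) (auto simp: pairwise_def orthogonal_def dot_square_norm)
    then show ?thesis
      using that finB by simp
  qed
  then have id: "P x = x" if "x \<in> V" for x
    using linear_eq_on_span[OF lin linear_id, of B x] that B(5) by simp
  have adj: "P v \<bullet> w = v \<bullet> P w" for v w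
    by (simp add: P_def inner_sum_left inner_sum_right inner_commute mult.commute)
  have "P v \<in> V" for v
    unfolding P_def using B(1) assms by (auto intro!: subspace_sum subspace_scale)
  then have "P v = 0 \<longleftrightarrow> (\<forall>w\<in>V. v \<bullet> w = 0)" for v
    \<comment> \<open>For the converse, test with \<open>w = P v\<close>: then \<open>v \<bullet> P v = v \<bullet> P (P v) = P v \<bullet> P v\<close>.\<close>
    by (metis adj id inner_eq_zero_iff inner_zero_left)
  with lin id show thesis
    by (rule that)
qed

text \<open>
  Being orthogonal to \<open>V\<close> means vanishing projection onto \<open>V\<close>, and on the compact slice the
  projection of a nondegenerate form is bounded away from \<open>0\<close>.
\<close>

lemma openin_nondegenerate_maps:
  fixes V :: "(real ^ 'n::finite) set"
  assumes V: "subspace V"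
  shows "openin (polynomial_maps_topology d) (nondegenerate_maps d V k)"
proof -
  interpret Metric_space "polynomial_maps d :: 'n polynomial_map set" frobenius_dist
    by (rule Metric_space_polynomial_maps)
  obtain P where P: "linear P" "\<And>x. x \<in> V \<Longrightarrow> P x = x"
    "\<And>v. P v = 0 \<longleftrightarrow> (\<forall>w\<in>V. v \<bullet> w = 0)"
    using orthogonal_projection_exists[OF V] by metis
  obtain a where a: "a > 0" "\<And>z. norm (P z) \<le> a * norm z"
    using linear_bounded_pos[OF P(1)] by blast
  obtain c where c: "c > 0" "\<And>(R :: 'n polynomial_map) x.
      (\<forall>i. \<bar>x $ i\<bar> \<le> 1) \<Longrightarrow> norm (top_form d R x) \<le> c * frobenius_norm R"
    using top_form_bounded_on_cube[of d] by metis
  let ?T = "normalised_slice V k"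
  have "\<exists>r>0. mball Q r \<subseteq> nondegenerate_maps d V k" if Q: "Q \<in> nondegenerate_maps d V k" for Q
  proof -
    have cont: "continuous_on ?T (\<lambda>x. norm (P (top_form d Q x)))"
      by (rule continuous_on_norm[OF linear_continuous_on_compose[OF
            continuous_on_polymonial_function[OF polynomial_function_top_form] P(1)]])
    obtain e where e: "e > 0" "\<And>x. x \<in> ?T \<Longrightarrow> e \<le> norm (P (top_form d Q x))"
    proof (cases "?T = {}")
      case True
      then show ?thesis
        using that[of 1] by simp
    next
      case False
      then obtain y where "y \<in> ?T" "\<And>x. x \<in> ?T \<Longrightarrow> norm (P (top_form d Q y)) \<le> norm (P (top_form d Q x))"
        using continuous_attains_inf[OF compact_normalised_slice[OF V] False cont] by blast
      moreover have "norm (P (top_form d Q y)) > 0"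
        using Q \<open>y \<in> ?T\<close> P(3) by (auto simp: nondegenerate_maps_def)
      ultimately show ?thesis
        using that by blast
    qed
    have "mball Q (e / (a * c)) \<subseteq> nondegenerate_maps d V k"
    proof
      fix R assume R: "R \<in> mball Q (e / (a * c))"
      have "P (top_form d R x) \<noteq> 0" if x: "x \<in> ?T" for x
      proof
        assume "P (top_form d R x) = 0"
        then have "e \<le> norm (P (top_form d (Q - R) x))"
          using e(2)[OF x] by (simp add: top_form_diff linear_diff[OF P(1)])
        also have "\<dots> \<le> a * norm (top_form d (Q - R) x)"
          by (rule a(2))
        also have "\<dots> \<le> a * (c * frobenius_norm (Q - R))"
          using a(1) x by (intro mult_left_mono c(2)) (auto simp: normalised_slice_def)
        also have "\<dots> < e"
          using R a(1) c(1) by (simp add: frobenius_dist_def field_simps)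
        finally show False by simp
      qed
      then show "R \<in> nondegenerate_maps d V k"
        using R P(3) by (auto simp: nondegenerate_maps_def)
    qed
    moreover have "e / (a * c) > 0"
      using e(1) a(1) c(1) by simp
    ultimately show ?thesis
      by blast
  qed
  then show ?thesis
    by (auto simp: polynomial_maps_topology_def openin_mtopology nondegenerate_maps_def)
qed

text \<open>
  The parameters \<open>x\<close> in \<open>V\<close> with \<open>x\<^sub>k = 1\<close> and \<open>v\<close> orthogonal to \<open>V\<close> together have, if such \<open>x\<close> exist
  at all, one degree of freedom less than the space has dimensions. Adding them up turns this count into the statement that \<open>x + v\<close>
  lies in a hyperplane, from which \<open>x\<close> and \<open>v\<close> are recovered by the projection onto \<open>V\<close> and its
  complement.
\<close>

lemma negligible_bad_shifts:
  fixes V :: "(real ^ 'n::finite) set" and F :: "real ^ 'n \<Rightarrow> real ^ 'n"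
  assumes V: "subspace V" and F: "polynomial_function F"
  shows "negligible {b. \<exists>x\<in>V. x $ k = 1 \<and> (\<forall>w\<in>V. (F x + b) \<bullet> w = 0)}"
proof -
  obtain P where P: "linear P" "\<And>x. x \<in> V \<Longrightarrow> P x = x"
    "\<And>v. P v = 0 \<longleftrightarrow> (\<forall>w\<in>V. v \<bullet> w = 0)"
    using orthogonal_projection_exists[OF V] by metis
  define a where "a = adjoint P (axis k 1)"
  define G where "G = (\<lambda>z. z - P z - F (P z))"
  have a: "a \<bullet> z = P z $ k" for z
    using adjoint_works[OF P(1), of z "axis k 1"] by (simp add: a_def inner_axis inner_commute)
  have "polynomial_function P"
    by (intro polynomial_function_bounded_linear linear_conv_bounded_linear[THEN iffD1] P(1))
  then have "polynomial_function G"
    unfolding G_def using polynomial_function_compose[OF _ F, of P]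
    by (intro polynomial_function_diff polynomial_function_id) (auto simp: o_def)
  then have "negligible (G ` {z. a \<bullet> z = 1})"
    by (intro negligible_differentiable_image_negligible negligible_hyperplane
          differentiable_on_polynomial_function) auto
  moreover have "b \<in> G ` {z. a \<bullet> z = 1}"
    if "x \<in> V" "x $ k = 1" "\<forall>w\<in>V. (F x + b) \<bullet> w = 0" for b x
  proof
    \<comment> \<open>Here \<open>v = F x + b\<close>, so that \<open>x\<close> and \<open>v\<close> are the components of \<open>x + v\<close> in \<open>V\<close> and its complement.\<close>
    let ?z = "x + (F x + b)"
    have "P (F x + b) = 0"
      using P(3) that by blast
    then have "P ?z = x"
      using P(2)[OF \<open>x \<in> V\<close>] linear_add[OF P(1), of x "F x + b"] by simp
    then show "b = G ?z" and "?z \<in> {z. a \<bullet> z = 1}"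
      using that by (simp_all add: G_def a)
  qed
  ultimately show ?thesis
    by (auto intro: negligible_subset)
qed

lemma dense_nondegenerate_maps:
  fixes V :: "(real ^ 'n::finite) set"
  assumes V: "subspace V"
  shows "polynomial_maps_topology d closure_of nondegenerate_maps d V k
         = topspace (polynomial_maps_topology d)"
proof -
  interpret Metric_space "polynomial_maps d :: 'n polynomial_map set" frobenius_dist
    by (rule Metric_space_polynomial_maps)
  have "\<exists>R\<in>nondegenerate_maps d V k. R \<in> mball Q r"
    if Q: "Q \<in> polynomial_maps d" and "r > 0" for Q :: "'n polynomial_map" and r :: real
  proof -
    let ?bad = "{b. \<exists>x\<in>V. x $ k = 1 \<and> (\<forall>w\<in>V. (top_form d Q x + b) \<bullet> w = 0)}"
    have "\<not> ball 0 r \<subseteq> ?bad"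
      using negligible_subset[OF negligible_bad_shifts[OF V polynomial_function_top_form]]
        open_not_negligible[OF open_ball, of 0 r] \<open>r > 0\<close>
      by (meson ball_eq_empty not_le)
    then obtain b where b: "norm b < r" "b \<notin> ?bad"
      unfolding subset_iff mem_ball_0 by blast
    let ?R = "Q + coordinate_power_map d k b"
    have R: "?R \<in> polynomial_maps d"
      using Q by (rule add_coordinate_power_map_mem)
    have "frobenius_dist Q ?R < r"
      using b(1) by (simp add: frobenius_dist_def frobenius_norm_minus frobenius_norm_coordinate_power_map)
    moreover have "?R \<in> nondegenerate_maps d V k"
      using R b(2)
      by (auto simp: nondegenerate_maps_def normalised_slice_def top_form_add top_form_coordinate_power_map)
    ultimately show ?thesis
      using Q R by auto
  qed
  then show ?thesis
    by (auto simp: polynomial_maps_topology_def metric_closure_of)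
qed

section \<open>Polyhedral cones\<close>

definition rows_kernel :: "(nat \<Rightarrow> real ^ 'n) \<Rightarrow> nat set \<Rightarrow> (real ^ 'n) set" where
  "rows_kernel C A = {w. \<forall>i\<in>A. C i \<bullet> w = 0}"

lemma subspace_rows_kernel: "subspace (rows_kernel C A)"
  by (auto simp: rows_kernel_def subspace_def inner_add_right)

text \<open>
  Near \<open>x\<close>, moving in a direction along which the active rows vanish does not leave the cone, because
  the finitely many other rows are strictly negative at \<open>x\<close>. Moving both forwards and backwards turns
  the variational inequality into an equation.
\<close>

lemma SOL_polyhedral_cone_orthogonal:
  assumes x: "x \<in> SOL (polyhedral_cone s C) F" and w: "w \<in> rows_kernel C (active_rows s C x)"
  shows "F x \<bullet> w = 0"
proof -
  have ge: "F x \<bullet> u \<ge> 0" if u: "u \<in> rows_kernel C (active_rows s C x)" for u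
  proof -
    have "eventually (\<lambda>t. C i \<bullet> (x + t *\<^sub>R u) \<le> 0) (at_right 0)" if "i < s" for i
    proof (cases "C i \<bullet> x = 0")
      case True
      then show ?thesis
        using u that by (simp add: rows_kernel_def active_rows_def inner_add_right)
    next
      case False
      then have neg: "C i \<bullet> x < 0"
        using x that by (force simp: SOL_def polyhedral_cone_def)
      have "((\<lambda>t. C i \<bullet> (x + t *\<^sub>R u)) \<longlongrightarrow> C i \<bullet> (x + 0 *\<^sub>R u)) (at_right 0)"
        by (intro tendsto_intros)
      then have "eventually (\<lambda>t. C i \<bullet> (x + t *\<^sub>R u) < 0) (at_right 0)"
        using neg by (intro order_tendstoD(2)) auto
      then show ?thesis
        by eventually_elim simp
    qed
    then have "eventually (\<lambda>t. \<forall>i\<in>{..<s}. C i \<bullet> (x + t *\<^sub>R u) \<le> 0) (at_right 0)"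
      by (intro eventually_ball_finite) auto
    then have "eventually (\<lambda>t. t > 0 \<and> x + t *\<^sub>R u \<in> polyhedral_cone s C) (at_right 0)"
      using eventually_at_right_less[of "0 :: real"]
      by eventually_elim (simp add: polyhedral_cone_def)
    then obtain t :: real where "t > 0" "x + t *\<^sub>R u \<in> polyhedral_cone s C"
      using eventually_happens trivial_limit_at_right_real by blast
    moreover have "F x \<bullet> ((x + t *\<^sub>R u) - x) \<ge> 0"
      using x \<open>x + t *\<^sub>R u \<in> polyhedral_cone s C\<close> unfolding SOL_def by blast
    ultimately show ?thesis
      by (simp add: zero_le_mult_iff)
  qed
  have "- w \<in> rows_kernel C (active_rows s C x)"
    using w by (simp add: rows_kernel_def)
  then show ?thesis
    using ge[OF w] ge[of "- w"] by simp
qed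

lemma nondegenerate_maps_imp_R0_maps:
  fixes C :: "nat \<Rightarrow> real ^ 'n::finite"
  assumes "d > 0" and K: "asymptotic_cone K = polyhedral_cone s C"
    and Q: "\<And>A k. A \<subseteq> {..<s} \<Longrightarrow> Q \<in> nondegenerate_maps d (rows_kernel C A) k"
  shows "Q \<in> R0_maps K d"
proof -
  have nonorth: "\<exists>w\<in>rows_kernel C A. top_form d Q x \<bullet> w \<noteq> 0"
    if "A \<subseteq> {..<s}" "x \<in> rows_kernel C A" "x \<noteq> 0" for A x
    using that Q by (intro nondegenerate_maps_imp_not_orthogonal subspace_rows_kernel)
  \<comment> \<open>The empty set of rows forces the top form to be nonzero, hence the degree to be exactly \<open>d\<close>.\<close>
  have "\<exists>w\<in>rows_kernel C {}. top_form d Q (axis undefined 1) \<bullet> w \<noteq> 0"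
    by (rule nonorth) (auto simp: rows_kernel_def axis_eq_0_iff)
  then have "top_form d Q (axis undefined 1) \<noteq> 0"
    by auto
  then have deg: "map_degree Q = d"
    using Q[of "{}"] by (intro map_degree_eq) (auto simp: nondegenerate_maps_def)
  have "SOL (polyhedral_cone s C) (top_form d Q) = {0}"
  proof
    show "SOL (polyhedral_cone s C) (top_form d Q) \<subseteq> {0}"
    proof
      fix x assume x: "x \<in> SOL (polyhedral_cone s C) (top_form d Q)"
      have "active_rows s C x \<subseteq> {..<s}" "x \<in> rows_kernel C (active_rows s C x)"
        by (auto simp: active_rows_def rows_kernel_def)
      then show "x \<in> {0}"
        using nonorth SOL_polyhedral_cone_orthogonal[OF x] by blast
    qed
    have "top_form d Q 0 = 0"
      using top_form_scaleR[of d Q 0 0] zero_power[OF \<open>d > 0\<close>, where 'a = real] by simp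
    then show "{0} \<subseteq> SOL (polyhedral_cone s C) (top_form d Q)"
      by (simp add: SOL_def polyhedral_cone_def)
  qed
  then show ?thesis
    by (simp add: R0_maps_def R0_pair_def K deg eval_leading_part[OF deg])
qed

theorem theorem5p1:
  fixes d s :: nat
    and I :: "'i set" and J :: "'j set"
    and g :: "'i \<Rightarrow> real ^ 'n \<Rightarrow> real" and h :: "'j \<Rightarrow> real ^ 'n \<Rightarrow> real"
    and K :: "(real ^ 'n) set"
    and C :: "nat \<Rightarrow> real ^ 'n"
  assumes "d > 0"
    and "finite I" and "finite J"
    and "\<And>i. i \<in> I \<Longrightarrow> real_polynomial_function (g i) \<and> convex_on UNIV (g i)"
    and "\<And>j. j \<in> J \<Longrightarrow> affine_function (h j)"
    and "K = {x. (\<forall>i\<in>I. g i x \<le> 0) \<and> (\<forall>j\<in>J. h j x = 0)}"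
    and "K \<noteq> {}"
    and "asymptotic_cone K = polyhedral_cone s C"
    and "LICQ s C"
  shows "generic_in (polynomial_maps_topology d) (R0_maps K d)"
proof -
  interpret Metric_space "polynomial_maps d :: 'n polynomial_map set" frobenius_dist
    by (rule Metric_space_polynomial_maps)
  let ?\<U> = "(\<lambda>(A, k). nondegenerate_maps d (rows_kernel C A) k) ` (Pow {..<s} \<times> (UNIV :: 'n set))"
  have "R0_maps K d \<subseteq> topspace (polynomial_maps_topology d)"
    by (auto simp: polynomial_maps_topology_def R0_maps_def intro: map_degree_le_imp_polynomial_maps)
  moreover have "countable ?\<U>"
    by (intro countable_finite) simp
  moreover have "\<forall>U\<in>?\<U>. openin (polynomial_maps_topology d) U \<and>
      polynomial_maps_topology d closure_of U = topspace (polynomial_maps_topology d)"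
    by (auto simp del: topspace_mtopology
        intro!: openin_nondegenerate_maps dense_nondegenerate_maps subspace_rows_kernel)
  moreover have "\<Inter>?\<U> \<subseteq> R0_maps K d"
    using nondegenerate_maps_imp_R0_maps[OF \<open>d > 0\<close> \<open>asymptotic_cone K = polyhedral_cone s C\<close>]
    by fastforce
  ultimately show ?thesis
    unfolding generic_in_def by (intro conjI exI[of _ ?\<U>]) auto
qed

end
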